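(* Let $P \subset \mathbb{R}^n$ be a full-dimensional polytope containing the origin in its interior, and let $K \subset \mathbb{R}^m$ be a full-dimensional closed convex cone. If $P$ has a proper $K$-lift, then every slack matrix of $P$ admits a $K$-factorization. Conversely, if some slack matrix of $P$ has a $K$-factorization, then $P$ has a $K$-lift.
   Context: A $K$-lift of a convex set $C \subset \mathbb{R}^n$ is a set $Q = K \cap L$, where $L \subset \mathbb{R}^m$ is an affine subspace, together with a linear map $\pi : \mathbb{R}^m \to \mathbb{R}^n$ such that $C = \pi(Q)$. The $K$-lift is proper if $L$ intersects the interior of $K$. The dual cone of $K$ is $K^* = \{ y \in \mathbb{R}^m : \langle x, y\rangle \ge 0 \ \ \forall x \in K\}$. Let $P$ have vertices $p_1,\dots,p_v$ and let $P = \{x \in \mathbb{R}^n : h_1(x) \ge 0, \dots, h_f(x)\ge 0\}$ be an irredundant inequality representation with each $h_j$ an affine-linear function (so the inequalities are in bijection with the facets of $P$). The $v \times f$ nonnegative matrix with $(i,j)$-entry $h_j(p_i)$ is a slack matrix of $P$. Since each facet inequality is unique only up to a positive scalar, slack matrices of $P$ are unique only up to multiplication of columns by positive scalars (and the ordering of vertices and facets). A $K$-factorization of a nonnegative matrix $M = (M_{ij}) \in \mathbb{R}_+^{p\times q}$ is a pair of ordered sets $\{a^1,\dots,a^p\} \subset K$ and $\{b^1,\dots,b^q\} \subset K^*$ such that $\langle a^i, b^j\rangle = M_{ij}$ for all $i,j$. *)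

theory Defs
  imports "HOL-Analysis.Analysis"
begin

definition is_lift ::
  "(real^'m) set \<Rightarrow> (real^'n) set \<Rightarrow> (real^'m) set \<Rightarrow> (real^'m \<Rightarrow> real^'n) \<Rightarrow> bool"
  where "is_lift K C L \<pi> \<longleftrightarrow> affine L \<and> linear \<pi> \<and> C = \<pi> ` (K \<inter> L)"

definition has_lift :: "(real^'m) set \<Rightarrow> (real^'n) set \<Rightarrow> bool"
  where "has_lift K C \<longleftrightarrow> (\<exists>L \<pi>. is_lift K C L \<pi>)"

definition has_proper_lift :: "(real^'m) set \<Rightarrow> (real^'n) set \<Rightarrow> bool"
  where "has_proper_lift K C \<longleftrightarrow> (\<exists>L \<pi>. is_lift K C L \<pi> \<and> L \<inter> interior K \<noteq> {})"

definition dual_cone :: "(real^'m) set \<Rightarrow> (real^'m) set"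
  where "dual_cone K = {y. \<forall>x\<in>K. x \<bullet> y \<ge> 0}"

definition affine_linear :: "(real^'n \<Rightarrow> real) \<Rightarrow> bool"
  where "affine_linear h \<longleftrightarrow> (\<exists>l c. \<forall>x. h x = l \<bullet> x + c)"

text \<open>Irredundant: dropping any single inequality changes the set it describes.\<close>

definition irredundant_representation ::
  "(real^'n) set \<Rightarrow> nat \<Rightarrow> (nat \<Rightarrow> real^'n \<Rightarrow> real) \<Rightarrow> bool"
  where "irredundant_representation P f h \<longleftrightarrow>
    (\<forall>j<f. affine_linear (h j)) \<and>
    P = {x. \<forall>j<f. h j x \<ge> 0} \<and>
    (\<forall>k<f. {x. \<forall>j<f. j \<noteq> k \<longrightarrow> h j x \<ge> 0} \<noteq> P)"

text \<open>
  The numbers of vertices and facets vary with the polytope, so a p-by-q matrix is a function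
  \<open>M :: nat \<Rightarrow> nat \<Rightarrow> real\<close> of which only the entries \<open>M i j\<close> with \<open>i < p\<close>, \<open>j < q\<close> matter.
  Choosing the enumeration of the vertices and the functions \<open>h j\<close> freely accounts for the
  reorderings and positive column scalings of slack matrices.
\<close>

definition slack_matrix ::
  "(real^'n) set \<Rightarrow> nat \<Rightarrow> nat \<Rightarrow> (nat \<Rightarrow> nat \<Rightarrow> real) \<Rightarrow> bool"
  where "slack_matrix P v f M \<longleftrightarrow>
    (\<exists>p h. bij_betw p {..<v} {x. x extreme_point_of P} \<and>
      irredundant_representation P f h \<and>
      (\<forall>i<v. \<forall>j<f. M i j = h j (p i)))"

text \<open>A matrix with such a factorization is automatically nonnegative on its index range.\<close>

definition has_factorization ::
  "(real^'m) set \<Rightarrow> nat \<Rightarrow> nat \<Rightarrow> (nat \<Rightarrow> nat \<Rightarrow> real) \<Rightarrow> bool"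
  where "has_factorization K p q M \<longleftrightarrow>
    (\<exists>a b. (\<forall>i<p. a i \<in> K) \<and> (\<forall>j<q. b j \<in> dual_cone K) \<and>
      (\<forall>i<p. \<forall>j<q. a i \<bullet> b j = M i j))"

end

theory Submission
  imports Defs
begin

text \<open>
  A \<open>K\<close>-lift and a \<open>K\<close>-factorization carry the same information. A point of \<open>K\<close> above a vertex
  \<open>p\<^sub>i\<close> is the vector \<open>a\<^sup>i\<close>, and pulling back the facet function \<open>h\<^sub>j\<close> along the projection gives
  the functional \<open>b\<^sup>j\<close>.

  From a proper lift \<open>P = \<pi>(K \<inter> L)\<close>: the function \<open>h\<^sub>j \<circ> \<pi>\<close> is affine on \<open>L\<close> and nonnegative
  on \<open>K \<inter> L\<close>, and it has to agree on \<open>L\<close> with a linear functional that is nonnegative on all of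
  \<open>K\<close>. This is conic duality with \<open>L \<inter> interior K \<noteq> {}\<close> as Slater condition
  (\<open>dual_functional_on_affine_slice\<close>). Duality in general only yields a functional below
  \<open>h\<^sub>j \<circ> \<pi>\<close> by a nonnegative constant; the constant vanishes because \<open>h\<^sub>j\<close> takes the value \<open>0\<close> on
  \<open>P\<close>, which is what irredundancy provides (\<open>irredundant_inequality_tight\<close>).

  From a factorization: let \<open>L\<close> consist of the \<open>z\<close> whose values \<open>\<langle>z, b\<^sup>j\<rangle>\<close> are the slacks
  \<open>h\<^sub>j(x)\<close> of some point \<open>x\<close>. Since \<open>P\<close> is bounded and has an interior point, \<open>x\<close> is a
  linear function of its slacks, homogeneously and without constant term
  (\<open>point_recovered_from_slacks\<close>), and this gives a linear \<open>\<pi>\<close> that sends \<open>z\<close> to \<open>x\<close>. Elements of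
  \<open>K \<inter> L\<close> have nonnegative slacks, hence land in \<open>P\<close>, and the image is convex and contains each
  vertex \<open>p\<^sub>i = \<pi>(a\<^sup>i)\<close>, hence all of \<open>P\<close>.
\<close>

section \<open>Affine-linear functions\<close>

lemma affine_linear_combination:
  assumes "affine_linear h"
  shows "h ((1 - t) *\<^sub>R x + t *\<^sub>R y) = (1 - t) * h x + t * h y"
proof -
  obtain l c where "\<And>x. h x = l \<bullet> x + c"
    using assms unfolding affine_linear_def by blast
  then show ?thesis
    by (simp add: inner_add_right algebra_simps)
qed

lemma affine_linear_compose_linear:
  fixes \<pi> :: "real^'m \<Rightarrow> real^'n"
  assumes "affine_linear h" and "linear \<pi>"
  shows "affine_linear (\<lambda>x. h (\<pi> x))"
proof -
  obtain l c where "\<And>x. h x = l \<bullet> x + c"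
    using assms(1) unfolding affine_linear_def by blast
  then have "h (\<pi> x) = adjoint \<pi> l \<bullet> x + c" for x
    using adjoint_works[OF assms(2), of x l] by (simp add: inner_commute)
  then show ?thesis
    unfolding affine_linear_def by blast
qed

text \<open>
  A point violating only the \<open>k\<close>-th inequality can be joined to a point of \<open>P\<close> by a segment, along
  which all other inequalities stay valid; the segment leaves \<open>P\<close> where the \<open>k\<close>-th one is tight.
\<close>

lemma irredundant_inequality_tight:
  assumes irr: "irredundant_representation P f h" and "k < f" and "p \<in> P"
  obtains z where "z \<in> P" "h k z = 0"
proof -
  have aff: "\<And>j. j < f \<Longrightarrow> affine_linear (h j)"
    and P: "P = {x. \<forall>j<f. h j x \<ge> 0}"
    and ne: "{x. \<forall>j<f. j \<noteq> k \<longrightarrow> h j x \<ge> 0} \<noteq> P"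
    using irr \<open>k < f\<close> unfolding irredundant_representation_def by blast+
  have "P \<subseteq> {x. \<forall>j<f. j \<noteq> k \<longrightarrow> h j x \<ge> 0}"
    unfolding P by blast
  then obtain q where q: "\<And>j. j < f \<Longrightarrow> j \<noteq> k \<Longrightarrow> h j q \<ge> 0" and "q \<notin> P"
    using ne by blast
  then have qk: "h k q < 0"
    unfolding P by force
  have p: "\<And>j. j < f \<Longrightarrow> h j p \<ge> 0"
    using \<open>p \<in> P\<close> unfolding P by blast
  define t where "t = h k p / (h k p - h k q)"
  have t: "0 \<le> t" "t \<le> 1"
    using p[OF \<open>k < f\<close>] qk unfolding t_def by (auto simp: field_simps)
  define z where "z = (1 - t) *\<^sub>R p + t *\<^sub>R q"
  have z: "h j z = (1 - t) * h j p + t * h j q" if "j < f" for j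
    unfolding z_def by (rule affine_linear_combination[OF aff[OF that]])
  have zk: "h k z = 0"
    using z[OF \<open>k < f\<close>] p[OF \<open>k < f\<close>] qk unfolding t_def by (simp add: field_simps)
  have "h j z \<ge> 0" if "j < f" for j
  proof (cases "j = k")
    case False
    then show ?thesis
      using z[OF that] p[OF that] q[OF that] t by simp
  qed (simp add: zk)
  then have "z \<in> P"
    unfolding P by blast
  then show thesis
    using zk that by blast
qed

section \<open>Conic duality on an affine slice\<close>

lemma convex_cone_mult:
  assumes "convex_cone K" "x \<in> K" "0 \<le> t"
  shows "t *\<^sub>R x \<in> K"
  using assms unfolding convex_cone_def conic_def by blast

lemma dual_cone_positive_on_interior:
  assumes "b \<in> dual_cone K" "b \<noteq> 0" "y \<in> interior K"
  shows "y \<bullet> b > 0"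
proof -
  obtain e where "e > 0" and e: "ball y e \<subseteq> K"
    using assms(3) by (meson mem_interior)
  define s where "s = e / (2 * norm b)"
  have s: "s > 0"
    using \<open>e > 0\<close> assms(2) unfolding s_def by simp
  have "dist y (y - s *\<^sub>R b) < e"
    using \<open>e > 0\<close> assms(2) unfolding s_def dist_norm by simp
  then have "y - s *\<^sub>R b \<in> K"
    using e by auto
  then have "y \<bullet> b \<ge> s * (b \<bullet> b)"
    using assms(1) unfolding dual_cone_def by (force simp: inner_diff_left)
  moreover have "s * (b \<bullet> b) > 0"
    using s assms(2) by simp
  ultimately show ?thesis
    by linarith
qed

text \<open>
  From a zero of \<open>g\<close> at an interior point of \<open>K\<close> one can move a little in every direction of \<open>L\<close> and its opposite without leaving \<open>K\<close>. Being nonnegative on both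
  sides, \<open>g\<close> vanishes there.
\<close>

lemma affine_linear_zero_of_interior_zero:
  assumes "affine L" and g: "affine_linear g"
    and nonneg: "\<And>x. x \<in> K \<inter> L \<Longrightarrow> g x \<ge> 0"
    and y: "y \<in> interior K" "y \<in> L" "g y = 0" and "w \<in> L"
  shows "g w = 0"
proof -
  obtain e where "e > 0" and e: "ball y e \<subseteq> K"
    using y(1) by (meson mem_interior)
  have step: "t * g w \<ge> 0" if t: "\<bar>t\<bar> * norm (w - y) < e" for t
  proof -
    let ?u = "(1 - t) *\<^sub>R y + t *\<^sub>R w"
    have "y - ?u = - (t *\<^sub>R (w - y))"
      by (simp add: algebra_simps)
    then have "?u \<in> K"
      using e t by (auto simp: dist_norm)
    moreover have "?u \<in> L"
      using \<open>affine L\<close> y(2) \<open>w \<in> L\<close> unfolding affine_def by simp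
    ultimately show ?thesis
      using nonneg[of ?u] affine_linear_combination[OF g] y(3) by simp
  qed
  define N where "N = norm (w - y)"
  have "N \<ge> 0"
    unfolding N_def by simp
  define t where "t = e / (N + 1)"
  have t: "t > 0"
    using \<open>e > 0\<close> \<open>N \<ge> 0\<close> unfolding t_def by simp
  have "t * N < t * (N + 1)"
    using t by simp
  also have "\<dots> = e"
    using \<open>N \<ge> 0\<close> unfolding t_def by simp
  finally have "t * norm (w - y) < e"
    unfolding N_def .
  then have "t * g w \<ge> 0" "(- t) * g w \<ge> 0"
    using step[of t] step[of "- t"] t by auto
  then have "t * g w = 0"
    by simp
  then show ?thesis
    using t by simp
qed

text \<open>
  Unless \<open>g\<close> vanishes on \<open>L\<close>, it is positive on the interior points of the slice, so its zero set
  in \<open>L\<close> is an affine set that misses \<open>interior K\<close> but touches \<open>K\<close> in \<open>x\<^sub>0\<close>. A hyperplane separating it from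
  \<open>K\<close> must pass through \<open>0\<close> and contain the zero set, so its normal vector restricts on \<open>L\<close> to a
  multiple of \<open>g\<close>; the multiple is positive because the hyperplane misses the interior points.
\<close>

lemma dual_functional_on_affine_slice:
  fixes K L :: "(real^'m) set"
  assumes K: "convex_cone K" and L: "affine L" and g: "affine_linear g"
    and nonneg: "\<And>x. x \<in> K \<inter> L \<Longrightarrow> g x \<ge> 0"
    and y0: "y\<^sub>0 \<in> interior K" "y\<^sub>0 \<in> L"
    and x0: "x\<^sub>0 \<in> K" "x\<^sub>0 \<in> L" "g x\<^sub>0 = 0"
  obtains b where "b \<in> dual_cone K" "\<And>x. x \<in> L \<Longrightarrow> x \<bullet> b = g x"
proof (cases "\<exists>y \<in> interior K \<inter> L. g y = 0")
  case True
  then obtain y where y: "y \<in> interior K" "y \<in> L" "g y = 0"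
    by blast
  have "0 \<in> dual_cone K"
    unfolding dual_cone_def by simp
  moreover have "x \<bullet> 0 = g x" if "x \<in> L" for x
    using affine_linear_zero_of_interior_zero[OF L g nonneg y that] by simp
  ultimately show thesis
    using that by blast
next
  case False
  define Z where "Z = {x \<in> L. g x = 0}"
  have Z_comb: "(1 - t) *\<^sub>R x + t *\<^sub>R y \<in> Z" if "x \<in> Z" "y \<in> Z" for x y t
    using that L affine_linear_combination[OF g] unfolding Z_def affine_def by simp
  have "convex Z"
    unfolding convex_alt using Z_comb by blast
  moreover have "convex (interior K)"
    using K by (simp add: convex_cone_def)
  moreover have "x\<^sub>0 \<in> Z"
    using x0 unfolding Z_def by simp
  moreover have "Z \<inter> interior K = {}"
    using False unfolding Z_def by blast
  ultimately obtain b c where "b \<noteq> 0"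
    and bZ: "\<And>x. x \<in> Z \<Longrightarrow> b \<bullet> x \<le> c" and b_int: "\<And>x. x \<in> interior K \<Longrightarrow> b \<bullet> x \<ge> c"
    using separating_hyperplane_sets[of Z "interior K"] y0(1) by blast
  have "closure (interior K) \<subseteq> {x. b \<bullet> x \<ge> c}"
    using b_int by (intro closure_minimal closed_halfspace_ge) auto
  moreover have "closure (interior K) = closure K"
    using K y0(1) by (intro convex_closure_interior) (auto simp: convex_cone_def)
  ultimately have bK: "b \<bullet> x \<ge> c" if "x \<in> K" for x
    using closure_subset that by blast
  have "c \<le> 0"
    using bK[OF convex_cone_mult[OF K x0(1), of 0]] by simp
  have b_nonneg: "b \<bullet> x \<ge> 0" if "x \<in> K" for x
  proof (rule ccontr)
    assume neg: "\<not> b \<bullet> x \<ge> 0"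
    have "0 \<le> (c - 1) / (b \<bullet> x)"
      using neg \<open>c \<le> 0\<close> by (simp add: divide_nonpos_neg)
    from bK[OF convex_cone_mult[OF K that this]] neg show False
      by simp
  qed
  then have dual: "b \<in> dual_cone K"
    unfolding dual_cone_def by (simp add: inner_commute)
  have bx0: "b \<bullet> x\<^sub>0 = 0"
    using b_nonneg[OF x0(1)] bZ[OF \<open>x\<^sub>0 \<in> Z\<close>] \<open>c \<le> 0\<close> by linarith
  have b_zero: "b \<bullet> x = 0" if "x \<in> Z" for x
  proof -
    \<comment> \<open>the reflection of \<open>x\<close> in \<open>x\<^sub>0\<close>\<close>
    have "(1 - 2) *\<^sub>R x + 2 *\<^sub>R x\<^sub>0 \<in> Z"
      using Z_comb[OF that \<open>x\<^sub>0 \<in> Z\<close>] .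
    from bZ[OF this] bZ[OF that] bx0 \<open>c \<le> 0\<close> show ?thesis
      by (simp add: inner_diff_right)
  qed
  have gy0: "g y\<^sub>0 > 0"
    using False nonneg[of y\<^sub>0] y0 interior_subset by fastforce
  have by0: "b \<bullet> y\<^sub>0 > 0"
    using dual_cone_positive_on_interior[OF dual \<open>b \<noteq> 0\<close> y0(1)] by (simp add: inner_commute)
  define r where "r = g y\<^sub>0 / (b \<bullet> y\<^sub>0)"
  have "x \<bullet> (r *\<^sub>R b) = g x" if "x \<in> L" for x
  proof -
    \<comment> \<open>Moving \<open>x\<close> parallel to \<open>y\<^sub>0 - x\<^sub>0\<close> to the zero set of \<open>g\<close> changes \<open>b\<close> and \<open>g\<close> in the fixed
      ratio of their values at \<open>y\<^sub>0\<close>.\<close>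
    define s where "s = g x / g y\<^sub>0"
    let ?u = "x - s *\<^sub>R (y\<^sub>0 - x\<^sub>0)"
    obtain l d where ld: "\<And>x. g x = l \<bullet> x + d"
      using g unfolding affine_linear_def by blast
    have "?u \<in> L"
      using mem_affine_3_minus[OF L \<open>x \<in> L\<close> x0(2) y0(2), of s] by (simp add: algebra_simps)
    moreover have "g ?u = g x - s * (g y\<^sub>0 - g x\<^sub>0)"
      unfolding ld by (simp add: inner_diff_right algebra_simps)
    then have "g ?u = 0"
      using x0(3) gy0 unfolding s_def by simp
    ultimately have "b \<bullet> ?u = 0"
      using b_zero unfolding Z_def by blast
    then have "b \<bullet> x = s * (b \<bullet> y\<^sub>0)"
      using bx0 by (simp add: inner_diff_right)
    then show ?thesis
      using gy0 by0 unfolding r_def s_def by (simp add: inner_commute field_simps)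
  qed
  moreover have "r *\<^sub>R b \<in> dual_cone K"
    using dual gy0 by0 unfolding dual_cone_def r_def by simp
  ultimately show thesis
    using that by blast
qed

theorem proper_lift_imp_factorization:
  fixes P :: "(real^'n) set" and K :: "(real^'m) set"
  assumes K: "convex_cone K" and "P \<noteq> {}"
    and lift: "has_proper_lift K P" and slack: "slack_matrix P v f M"
  shows "has_factorization K v f M"
proof -
  obtain L \<pi> y where L: "affine L" and \<pi>: "linear \<pi>" and P: "P = \<pi> ` (K \<inter> L)"
    and y: "y \<in> interior K" "y \<in> L"
    using lift unfolding has_proper_lift_def is_lift_def by blast
  obtain p h where p: "bij_betw p {..<v} {x. x extreme_point_of P}"
    and irr: "irredundant_representation P f h"
    and M: "\<And>i j. i < v \<Longrightarrow> j < f \<Longrightarrow> M i j = h j (p i)"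
    using slack unfolding slack_matrix_def by blast
  have "\<exists>a. a \<in> K \<inter> L \<and> \<pi> a = p i" if "i < v" for i
  proof -
    have "p i extreme_point_of P"
      using bij_betwE[OF p] that by auto
    then have "p i \<in> P"
      by (simp add: extreme_point_of_def)
    then show ?thesis
      unfolding P by force
  qed
  then obtain a where a: "\<And>i. i < v \<Longrightarrow> a i \<in> K \<inter> L \<and> \<pi> (a i) = p i"
    by metis
  have "\<exists>b. b \<in> dual_cone K \<and> (\<forall>x\<in>L. x \<bullet> b = h j (\<pi> x))" if j: "j < f" for j
  proof -
    have "affine_linear (h j)"
      using irr j unfolding irredundant_representation_def by blast
    then have g: "affine_linear (\<lambda>x. h j (\<pi> x))"
      using affine_linear_compose_linear \<pi> by blast
    have nonneg: "h j (\<pi> x) \<ge> 0" if "x \<in> K \<inter> L" for x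
    proof -
      have "\<pi> x \<in> P"
        unfolding P using that by blast
      then show ?thesis
        using irr j unfolding irredundant_representation_def by blast
    qed
    obtain z where "z \<in> P" "h j z = 0"
      using irredundant_inequality_tight[OF irr j] \<open>P \<noteq> {}\<close> by blast
    then obtain x where x: "x \<in> K" "x \<in> L" "h j (\<pi> x) = 0"
      unfolding P by blast
    show ?thesis
      using dual_functional_on_affine_slice[OF K L g nonneg y x] by metis
  qed
  then obtain b where b: "\<And>j. j < f \<Longrightarrow> b j \<in> dual_cone K \<and> (\<forall>x\<in>L. x \<bullet> b j = h j (\<pi> x))"
    by metis
  show ?thesis
    unfolding has_factorization_def using a b M by (intro exI[of _ a] exI[of _ b]) auto
qed

section \<open>Recovering a point from its slacks\<close>

lemma bounded_no_ray:
  fixes d :: "'a::real_normed_vector"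
  assumes "bounded S" and ray: "\<And>s. s \<ge> 0 \<Longrightarrow> x + s *\<^sub>R d \<in> S"
  shows "d = 0"
proof (rule ccontr)
  assume "d \<noteq> 0"
  obtain B where B: "\<And>z. z \<in> S \<Longrightarrow> norm z \<le> B"
    using assms(1) unfolding bounded_iff by blast
  define s where "s = (B + norm x + 1) / norm d"
  have "norm x \<le> B"
    using B[OF ray[of 0]] by simp
  then have "B + norm x + 1 > 0"
    using norm_ge_zero[of x] by linarith
  then have "s \<ge> 0" and eq: "norm (s *\<^sub>R d) = B + norm x + 1"
    using \<open>d \<noteq> 0\<close> unfolding s_def by auto
  have "norm (s *\<^sub>R d) \<le> norm (x + s *\<^sub>R d) + norm x"
    using norm_triangle_ineq4[of "x + s *\<^sub>R d" x] by simp
  then show False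
    using eq B[OF ray[OF \<open>s \<ge> 0\<close>]] by linarith
qed

text \<open>
  The homogenized inequalities have no common zero. A zero at height \<open>t = 0\<close> would be the
  direction of a line in \<open>P\<close>; a zero at height \<open>t \<noteq> 0\<close> would be a point where all inequalities are
  tight at once, making \<open>P\<close> a bounded cone with that apex, hence a
  single point.
\<close>

lemma homogenized_inequalities_no_common_zero:
  fixes P :: "(real^'n) set"
  assumes P: "P = {x. \<forall>j<f. l j \<bullet> x + c j \<ge> 0}" and "bounded P" and int: "0 \<in> interior P"
    and zero: "\<And>j. j < f \<Longrightarrow> l j \<bullet> x + c j * t = 0"
  shows "x = 0 \<and> t = 0"
proof -
  have mem0: "0 \<in> P"
    using int interior_subset by blast
  show ?thesis
  proof (cases "t = 0")
    case True
    have "0 + s *\<^sub>R x \<in> P" for s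
      using zero mem0 unfolding P True by simp
    then show ?thesis
      using bounded_no_ray[OF \<open>bounded P\<close>] True by blast
  next
    case False
    define y where "y = (1 / t) *\<^sub>R x"
    have y: "l j \<bullet> y + c j = 0" if "j < f" for j
      using zero[OF that] False unfolding y_def by (simp add: field_simps)
    have "p = y" if "p \<in> P" for p
    proof -
      have "y + s *\<^sub>R (p - y) \<in> P" if "s \<ge> 0" for s
      proof -
        have "l j \<bullet> (y + s *\<^sub>R (p - y)) + c j = s * (l j \<bullet> p + c j)" if "j < f" for j
        proof -
          have "c j = - (l j \<bullet> y)"
            using y[OF that] by linarith
          then show ?thesis
            by (simp add: inner_add_right inner_diff_right algebra_simps)
        qed
        then show ?thesis
          using \<open>p \<in> P\<close> \<open>s \<ge> 0\<close> unfolding P by simp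
      qed
      then show ?thesis
        using bounded_no_ray[OF \<open>bounded P\<close>] by force
    qed
    then have "P \<subseteq> {y}"
      by blast
    then have "interior P \<subseteq> {}"
      using interior_mono[of P "{y}"] by simp
    then show ?thesis
      using int by blast
  qed
qed

text \<open>
  Put \<open>w\<^sub>j = (l\<^sub>j, c\<^sub>j)\<close>. As no nonzero vector is orthogonal to all \<open>w\<^sub>j\<close>, the frame operator
  \<open>v \<mapsto> \<Sum>\<^sub>j \<langle>w\<^sub>j, v\<rangle> w\<^sub>j\<close> is invertible; applying its inverse to this sum expresses \<open>v\<close> linearly in
  the numbers \<open>\<langle>w\<^sub>j, v\<rangle>\<close>. For \<open>v = (x, 1)\<close> these are the slacks of \<open>x\<close>.
\<close>

lemma point_recovered_from_slacks:
  fixes P :: "(real^'n) set"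
  assumes P: "P = {x. \<forall>j<f. l j \<bullet> x + c j \<ge> 0}" and "bounded P" and "0 \<in> interior P"
  obtains \<mu> :: "nat \<Rightarrow> real^'n" where "\<And>x. (\<Sum>j<f. (l j \<bullet> x + c j) *\<^sub>R \<mu> j) = x"
proof -
  define w where "w j = (l j, c j)" for j
  define S where "S v = (\<Sum>j<f. (w j \<bullet> v) *\<^sub>R w j)" for v
  have S: "linear S"
    unfolding S_def
    by (intro linearI) (simp_all add: inner_add_right scaleR_add_left sum.distrib scaleR_sum_right)
  have "v = 0" if "S v = 0" for v
  proof -
    have "(\<Sum>j<f. (w j \<bullet> v)\<^sup>2) = S v \<bullet> v"
      unfolding S_def by (simp add: inner_sum_left power2_eq_square)
    then have sq: "(\<Sum>j<f. (w j \<bullet> v)\<^sup>2) = 0"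
      using that by simp
    have "w j \<bullet> v = 0" if "j < f" for j
    proof -
      have "(w j \<bullet> v)\<^sup>2 = 0"
        using sq that by (subst (asm) sum_nonneg_eq_0_iff) auto
      then show ?thesis by simp
    qed
    then have "l j \<bullet> fst v + c j * snd v = 0" if "j < f" for j
      using that unfolding w_def by (simp add: inner_prod_def)
    then have "fst v = 0 \<and> snd v = 0"
      by (rule homogenized_inequalities_no_common_zero[OF assms])
    then show ?thesis
      by (simp add: prod_eq_iff)
  qed
  then have "inj S"
    using linear_injective_0[OF S] by blast
  then obtain T where T: "linear T" "T \<circ> S = id"
    using linear_injective_left_inverse[OF S] by blast
  have "(\<Sum>j<f. (l j \<bullet> x + c j) *\<^sub>R fst (T (w j))) = x" for x
  proof -
    have "(x, 1) = T (S (x, 1))"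
      using T(2) by (metis comp_apply id_apply)
    also have "\<dots> = (\<Sum>j<f. (w j \<bullet> (x, 1)) *\<^sub>R T (w j))"
      unfolding S_def by (simp add: linear_sum[OF T(1)] linear_scale[OF T(1)])
    finally have "x = fst (\<Sum>j<f. (w j \<bullet> (x, 1)) *\<^sub>R T (w j))"
      by (metis fst_conv)
    then show ?thesis
      unfolding w_def by (simp add: fst_sum)
  qed
  then show thesis
    using that[of "\<lambda>j. fst (T (w j))"] by blast
qed

theorem factorization_imp_lift:
  fixes P :: "(real^'n) set" and K :: "(real^'m) set"
  assumes "polytope P" and "0 \<in> interior P" and K: "convex_cone K"
    and slack: "slack_matrix P v f M" and fact: "has_factorization K v f M"
  shows "has_lift K P"
proof -
  obtain p h where p: "bij_betw p {..<v} {x. x extreme_point_of P}"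
    and irr: "irredundant_representation P f h"
    and M: "\<And>i j. i < v \<Longrightarrow> j < f \<Longrightarrow> M i j = h j (p i)"
    using slack unfolding slack_matrix_def by blast
  obtain a b where a: "\<And>i. i < v \<Longrightarrow> a i \<in> K" and b: "\<And>j. j < f \<Longrightarrow> b j \<in> dual_cone K"
    and ab: "\<And>i j. i < v \<Longrightarrow> j < f \<Longrightarrow> a i \<bullet> b j = M i j"
    using fact unfolding has_factorization_def by blast
  have "\<exists>l c. \<forall>x. h j x = l \<bullet> x + c" if "j < f" for j
    using irr that unfolding irredundant_representation_def affine_linear_def by blast
  then obtain l c where h: "\<And>j x. j < f \<Longrightarrow> h j x = l j \<bullet> x + c j"
    by metis
  have P: "P = {x. \<forall>j<f. l j \<bullet> x + c j \<ge> 0}"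
    using irr h unfolding irredundant_representation_def by auto
  obtain \<mu> where \<mu>: "\<And>x. (\<Sum>j<f. (l j \<bullet> x + c j) *\<^sub>R \<mu> j) = x"
    using point_recovered_from_slacks[OF P polytope_imp_bounded[OF assms(1)] assms(2)] by blast
  define L where "L = {z. \<exists>x. \<forall>j<f. z \<bullet> b j = l j \<bullet> x + c j}"
  define \<pi> where "\<pi> z = (\<Sum>j<f. (z \<bullet> b j) *\<^sub>R \<mu> j)" for z
  have \<pi>: "linear \<pi>"
    unfolding \<pi>_def
    by (intro linearI) (simp_all add: inner_add_left scaleR_add_left sum.distrib scaleR_sum_right)
  have \<pi>_eq: "\<pi> z = x" if "\<And>j. j < f \<Longrightarrow> z \<bullet> b j = l j \<bullet> x + c j" for z x
  proof -
    have "\<pi> z = (\<Sum>j<f. (l j \<bullet> x + c j) *\<^sub>R \<mu> j)"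
      unfolding \<pi>_def using that by (intro sum.cong) auto
    then show ?thesis
      using \<mu> by simp
  qed
  have L: "affine L"
    unfolding affine_def
  proof (intro ballI allI impI)
    fix z z' and u u' :: real
    assume z: "z \<in> L" "z' \<in> L" and u: "u + u' = 1"
    obtain x x' where x: "\<And>j. j < f \<Longrightarrow> z \<bullet> b j = l j \<bullet> x + c j"
      and x': "\<And>j. j < f \<Longrightarrow> z' \<bullet> b j = l j \<bullet> x' + c j"
      using z unfolding L_def by blast
    have "(u *\<^sub>R z + u' *\<^sub>R z') \<bullet> b j = l j \<bullet> (u *\<^sub>R x + u' *\<^sub>R x') + c j" if "j < f" for j
    proof -
      have "c j = (u + u') * c j"
        using u by simp
      then show ?thesis
        using x[OF that] x'[OF that] by (simp add: inner_add_left inner_add_right algebra_simps)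
    qed
    then show "u *\<^sub>R z + u' *\<^sub>R z' \<in> L"
      unfolding L_def by blast
  qed
  have "\<pi> ` (K \<inter> L) \<subseteq> P"
  proof
    fix y assume "y \<in> \<pi> ` (K \<inter> L)"
    then obtain z x where z: "z \<in> K" "y = \<pi> z"
      and x: "\<And>j. j < f \<Longrightarrow> z \<bullet> b j = l j \<bullet> x + c j"
      unfolding L_def by blast
    have "l j \<bullet> x + c j \<ge> 0" if "j < f" for j
      using b[OF that] z(1) x[OF that] unfolding dual_cone_def by fastforce
    then show "y \<in> P"
      using \<pi>_eq[OF x] z(2) unfolding P by simp
  qed
  moreover have "P \<subseteq> \<pi> ` (K \<inter> L)"
  proof -
    have "convex (\<pi> ` (K \<inter> L))"
      using K L \<pi> by (intro convex_linear_image convex_Int)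
        (auto simp: convex_cone_def affine_imp_convex)
    moreover have "{x. x extreme_point_of P} \<subseteq> \<pi> ` (K \<inter> L)"
    proof
      fix y assume "y \<in> {x. x extreme_point_of P}"
      then obtain i where i: "i < v" "y = p i"
        using bij_betw_imp_surj_on[OF p] by blast
      have ai: "a i \<bullet> b j = l j \<bullet> p i + c j" if "j < f" for j
        using ab[OF i(1) that] M[OF i(1) that] h[OF that] by simp
      then have "a i \<in> K \<inter> L"
        using a[OF i(1)] unfolding L_def by blast
      moreover have "\<pi> (a i) = y"
        using \<pi>_eq[of "a i" "p i"] ai i(2) by simp
      ultimately show "y \<in> \<pi> ` (K \<inter> L)"
        by blast
    qed
    moreover have "P = convex hull {x. x extreme_point_of P}"
      using Krein_Milman_Minkowski polytope_imp_compact polytope_imp_convex assms(1) by blast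
    ultimately show ?thesis
      by (metis hull_minimal)
  qed
  ultimately have "is_lift K P L \<pi>"
    unfolding is_lift_def using L \<pi> by blast
  then show ?thesis
    unfolding has_lift_def by blast
qed

section \<open>The equivalence of lifts and factorizations\<close>

theorem theorem3p3:
  fixes P :: "(real^'n) set" and K :: "(real^'m) set"
  assumes "polytope P" and "aff_dim P = int CARD('n)" and "0 \<in> interior P"
    and "closed K" and "convex_cone K" and "aff_dim K = int CARD('m)"
  shows "(has_proper_lift K P \<longrightarrow>
            (\<forall>v f M. slack_matrix P v f M \<longrightarrow> has_factorization K v f M)) \<and>
         ((\<exists>v f M. slack_matrix P v f M \<and> has_factorization K v f M) \<longrightarrow> has_lift K P)"
proof -
  have "P \<noteq> {}"
    using assms(3) by auto
  then show ?thesis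
    using proper_lift_imp_factorization[OF assms(5), of P]
      factorization_imp_lift[OF assms(1,3,5)] by metis
qed

end
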